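(* Consider the primal doubly nonnegative program $$\min\ \langle C,X\rangle \quad\text{s.t.}\quad \mathcal{A}X=b,\quad X\in\mathcal{S}_n^+,\quad X\ge 0,$$ let $X^*$ be an optimal solution of it and let $p^*$ be its optimal value. Given $y\in\mathbb{R}^m$ and $S\in\mathcal{S}_n$ with $S\ge 0$, set $$\tilde Z = C-\mathcal{A}^\top y - S$$ and let $\underline{z}\in\mathbb{R}$ satisfy $\underline{z}\le\lambda_{\min}(\tilde Z)$. Let $\bar x\in\mathbb{R}$ satisfy $\bar x\ge\lambda_{\max}(X^* )$. Then $$p^*\ \ge\ b^\top y+\bar x\sum_{k:\ \lambda_k(\tilde Z)<0}\lambda_k(\tilde Z)\ \ge\ b^\top y+n\,\bar x\,\min\{0,\underline{z}\}.$$
   Context: $\mathcal{S}_n$ is the set of real symmetric $n\times n$ matrices and $\mathcal{S}_n^+\subset\mathcal{S}_n$ the set of positive semidefinite ones; $\langle X,Y\rangle=\operatorname{trace}(XY)$ on $\mathcal{S}_n$. The data are $C\in\mathcal{S}_n$, $b\in\mathbb{R}^m$ and $A_1,\dots,A_m\in\mathcal{S}_n$. The linear operator $\mathcal{A}:\mathcal{S}_n\to\mathbb{R}^m$ is $(\mathcal{A}X)_i=\langle A_i,X\rangle$, and its adjoint $\mathcal{A}^\top:\mathbb{R}^m\to\mathcal{S}_n$ is $\mathcal{A}^\top y=\sum_{i=1}^m y_iA_i$. For matrices, $X\ge 0$ means that all entries are nonnegative. $\lambda_1(\tilde Z),\dots,\lambda_n(\tilde Z)$ are the eigenvalues of $\tilde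 Z$, counted with multiplicity, and $\lambda_{\min}$, $\lambda_{\max}$ denote the smallest and largest eigenvalue. *)

theory Defs
  imports Complex_Main "Jordan_Normal_Form.Char_Poly"
begin

definition sym_mats :: "nat \<Rightarrow> real mat set" where
  "sym_mats n = {X \<in> carrier_mat n n. transpose_mat X = X}"

definition psd_mats :: "nat \<Rightarrow> real mat set" where
  "psd_mats n = {X \<in> sym_mats n. \<forall>v \<in> carrier_vec n. v \<bullet> (X *\<^sub>v v) \<ge> 0}"

definition nonneg_entries :: "real mat \<Rightarrow> bool" where
  "nonneg_entries X \<longleftrightarrow> (\<forall>i < dim_row X. \<forall>j < dim_col X. X $$ (i, j) \<ge> 0)"

definition mat_trace :: "real mat \<Rightarrow> real" where
  "mat_trace X = (\<Sum>i < dim_row X. X $$ (i, i))"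

definition mat_inner :: "real mat \<Rightarrow> real mat \<Rightarrow> real" where
  "mat_inner X Y = mat_trace (X * Y)"

(* The data matrices A_1, ..., A_m are represented as A 0, ..., A (m - 1). *)

definition lin_op :: "nat \<Rightarrow> (nat \<Rightarrow> real mat) \<Rightarrow> real mat \<Rightarrow> real vec" where
  "lin_op m A X = vec m (\<lambda>i. mat_inner (A i) X)"

(* The matrix y_1 A_1 + ... + y_m A_m, with the sum taken entrywise because the type mat,
   having explicit dimensions, is not an instance of comm_monoid_add. *)
definition adj_op :: "nat \<Rightarrow> nat \<Rightarrow> (nat \<Rightarrow> real mat) \<Rightarrow> real vec \<Rightarrow> real mat" where
  "adj_op n m A y = mat n n (\<lambda>(i, j). \<Sum>k < m. (y $ k \<cdot>\<^sub>m A k) $$ (i, j))"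

(* Real eigenvalues with algebraic multiplicity; for symmetric matrices these are all
   the eigenvalues, so the multiset then has size n. *)
definition eigenvalues_mset :: "real mat \<Rightarrow> real multiset" where
  "eigenvalues_mset X = proots (char_poly X)"

(* Min and Max are meaningful for a symmetric matrix of positive dimension, whose set of
   eigenvalues is finite and nonempty. *)
definition lambda_min :: "real mat \<Rightarrow> real" where
  "lambda_min X = Min {l. eigenvalue X l}"

definition lambda_max :: "real mat \<Rightarrow> real" where
  "lambda_max X = Max {l. eigenvalue X l}"

definition dnn_feasible ::
  "nat \<Rightarrow> nat \<Rightarrow> (nat \<Rightarrow> real mat) \<Rightarrow> real vec \<Rightarrow> real mat set" where
  "dnn_feasible n m A b = {X \<in> psd_mats n. lin_op m A X = b \<and> nonneg_entries X}"

definition dnn_optimal ::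
  "nat \<Rightarrow> nat \<Rightarrow> real mat \<Rightarrow> (nat \<Rightarrow> real mat) \<Rightarrow> real vec \<Rightarrow> real mat \<Rightarrow> bool" where
  "dnn_optimal n m C A b X \<longleftrightarrow> X \<in> dnn_feasible n m A b
     \<and> (\<forall>Y \<in> dnn_feasible n m A b. mat_inner C X \<le> mat_inner C Y)"

definition dnn_value ::
  "nat \<Rightarrow> nat \<Rightarrow> real mat \<Rightarrow> (nat \<Rightarrow> real mat) \<Rightarrow> real vec \<Rightarrow> real" where
  "dnn_value n m C A b = (INF X \<in> dnn_feasible n m A b. mat_inner C X)"

end

theory Submission
  imports Defs "Jordan_Normal_Form.Schur_Decomposition"
begin

text \<open>
  Weak duality gives \<open>\<langle>C, X\<rangle> - b\<^sup>T y = \<langle>Z, X\<rangle> + \<langle>S, X\<rangle> \<ge> \<langle>Z, X\<rangle>\<close> for the optimal \<open>X\<close>. With a spectral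
  decomposition \<open>Z = \<Sum>\<^sub>k d\<^sub>k u\<^sub>k u\<^sub>k\<^sup>T\<close> one has \<open>\<langle>Z, X\<rangle> = \<Sum>\<^sub>k d\<^sub>k (u\<^sub>k\<^sup>T X u\<^sub>k)\<close>, where each factor
  \<open>u\<^sub>k\<^sup>T X u\<^sub>k\<close> lies between \<open>0\<close> and \<open>\<lambda>\<^sub>m\<^sub>a\<^sub>x(X)\<close>, so only the negative \<open>d\<^sub>k\<close> count, each with weight at
  most \<open>\<lambda>\<^sub>m\<^sub>a\<^sub>x(X)\<close>. The spectral theorem itself goes by deflation: split off one real eigenvector,
  completed to an orthonormal basis, and recurse on the remaining block.
\<close>

section \<open>Real eigenvectors and the spectral theorem for symmetric matrices\<close>

text \<open>Split the eigenvector into real and imaginary parts, \<open>v = x + i y\<close>.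
  Symmetry equates \<open>x \<bullet> A y\<close> with \<open>A x \<bullet> y\<close>; evaluating
  both leaves \<open>Im l\<close> times the squared norm of \<open>v\<close>, which is not
  zero.\<close>

lemma real_symmetric_complex_eigenvalue:
  fixes A :: "real mat"
  assumes A: "A \<in> carrier_mat n n" and sym: "A\<^sup>T = A"
    and ev: "eigenvector (map_mat complex_of_real A) v l"
  shows "Im l = 0"
proof -
  have v: "v \<in> carrier_vec n" and v0: "v \<noteq> 0\<^sub>v n"
    and eq: "map_mat complex_of_real A *\<^sub>v v = l \<cdot>\<^sub>v v"
    using ev A unfolding eigenvector_def by auto
  define x where "x = map_vec Re v"
  define y where "y = map_vec Im v"
  have x: "x \<in> carrier_vec n" and y: "y \<in> carrier_vec n"
    unfolding x_def y_def using v by auto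
  \<comment> \<open>As \<open>A\<close> is real, taking \<open>Re\<close> and \<open>Im\<close> of
    the eigenvector equation gives a coupled real system for \<open>x\<close> and
    \<open>y\<close>.\<close>
  have comp: "(A *\<^sub>v x) $ i = Re l * x $ i - Im l * y $ i"
    "(A *\<^sub>v y) $ i = Im l * x $ i + Re l * y $ i" if i: "i < n" for i
  proof -
    have "(map_mat complex_of_real A *\<^sub>v v) $ i = l * v $ i"
      using eq i v by simp
    moreover have "(map_mat complex_of_real A *\<^sub>v v) $ i
        = (\<Sum>j = 0..<n. complex_of_real (A $$ (i, j)) * v $ j)"
      using A v i by (auto simp: scalar_prod_def)
    ultimately have s: "(\<Sum>j = 0..<n. complex_of_real (A $$ (i, j)) * v $ j) = l * v $ i"
      by simp
    show "(A *\<^sub>v x) $ i = Re l * x $ i - Im l * y $ i"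
      using arg_cong[OF s, of Re] A v i
      by (simp add: x_def y_def scalar_prod_def)
    show "(A *\<^sub>v y) $ i = Im l * x $ i + Re l * y $ i"
      using arg_cong[OF s, of Im] A v i
      by (simp add: x_def y_def scalar_prod_def algebra_simps)
  qed
  have Ax: "A *\<^sub>v x = Re l \<cdot>\<^sub>v x - Im l \<cdot>\<^sub>v y"
    using comp x y A by (intro eq_vecI) auto
  have Ay: "A *\<^sub>v y = Im l \<cdot>\<^sub>v x + Re l \<cdot>\<^sub>v y"
    using comp x y A by (intro eq_vecI) auto
  have "x \<bullet> (A *\<^sub>v y) = (A *\<^sub>v x) \<bullet> y"
    using transpose_vec_mult_scalar[OF A y x] sym by simp
  moreover have "x \<bullet> (A *\<^sub>v y) = Im l * (x \<bullet> x) + Re l * (x \<bullet> y)"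
    unfolding Ay using x y by (simp add: scalar_prod_add_distrib[of _ n])
  moreover have "(A *\<^sub>v x) \<bullet> y = Re l * (x \<bullet> y) - Im l * (y \<bullet> y)"
    unfolding Ax using x y by (simp add: minus_scalar_prod_distrib[of _ n])
  \<comment> \<open>The terms \<open>Re l * (x \<bullet> y)\<close> cancel.\<close>
  ultimately have "Im l * (x \<bullet> x + y \<bullet> y) = 0"
    by (simp add: algebra_simps)
  moreover have "x \<bullet> x + y \<bullet> y \<noteq> 0"
  proof
    assume "x \<bullet> x + y \<bullet> y = 0"
    moreover have "x \<bullet> x \<ge> 0" "y \<bullet> y \<ge> 0"
      by (auto simp: scalar_prod_def intro: sum_nonneg)
    ultimately have "x \<bullet> x = 0" "y \<bullet> y = 0" by auto
    hence "x = 0\<^sub>v n" "y = 0\<^sub>v n"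
      using conjugate_square_eq_0_vec[OF x] conjugate_square_eq_0_vec[OF y] by auto
    hence "v $ i = 0" if "i < n" for i
      using that v by (auto simp: x_def y_def complex_eq_iff vec_eq_iff)
    hence "v = 0\<^sub>v n" using v by (intro eq_vecI) auto
    with v0 show False ..
  qed
  ultimately show ?thesis by simp
qed

text \<open>The fundamental theorem of algebra yields a complex root of the characteristic
  polynomial. It is real by the previous lemma, hence a root of the real polynomial too.\<close>

lemma real_symmetric_has_eigenvector:
  fixes A :: "real mat"
  assumes A: "A \<in> carrier_mat n n" and sym: "A\<^sup>T = A" and n: "n > 0"
  shows "\<exists>v e. eigenvector A v e"
proof -
  let ?B = "map_mat complex_of_real A"
  have B: "?B \<in> carrier_mat n n" using A by simp
  have "\<not> constant (poly (char_poly ?B))"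
    using degree_monic_char_poly[OF B] n by (simp add: constant_degree)
  then obtain l where l: "poly (char_poly ?B) l = 0"
    using fundamental_theorem_of_algebra by blast
  hence "eigenvalue ?B l" by (simp add: eigenvalue_root_char_poly[OF B])
  then obtain v where "eigenvector ?B v l" unfolding eigenvalue_def by auto
  from real_symmetric_complex_eigenvalue[OF A sym this]
  have "l = complex_of_real (Re l)" by (simp add: complex_eq_iff)
  hence "poly (map_poly complex_of_real (char_poly A)) (complex_of_real (Re l)) = 0"
    using l of_real_hom.char_poly_hom[OF A, where 'a = complex] by simp
  hence "eigenvalue A (Re l)"
    by (simp add: eigenvalue_root_char_poly[OF A] of_real_hom.poly_map_poly)
  thus ?thesis unfolding eigenvalue_def by auto
qed

text \<open>Extend \<open>v\<close> to a basis, apply Gram-Schmidt, which keeps the first vector,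
  and normalize. The factor \<open>c\<close> absorbs the normalization of \<open>v\<close>.\<close>

lemma orthonormal_completion:
  fixes v :: "real vec"
  assumes v: "v \<in> carrier_vec n" and v0: "v \<noteq> 0\<^sub>v n" and n: "n > 0"
  shows "\<exists>W c. W \<in> carrier_mat n n \<and> W\<^sup>T * W = 1\<^sub>m n \<and> col W 0 = c \<cdot>\<^sub>v v"
proof -
  interpret cof_vec_space n "TYPE(real)" .
  let ?b = "basis_completion v"
  define ws where "ws = gram_schmidt n ?b"
  note b = basis_completion[OF v v0]
  obtain vs where bv: "?b = v # vs"
    using b(6,7) n by (cases ?b) auto
  have ws: "set ws \<subseteq> carrier_vec n" "corthogonal ws" "length ws = n"
    using gram_schmidt_result[OF b(2,4,5) ws_def] b(6) by auto
  have hd: "ws ! 0 = v"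
    using gram_schmidt_hd[OF v, of vs] ws(3) n
    unfolding ws_def bv by (metis hd_conv_nth length_greater_0_conv)
  define c where "c i = 1 / sqrt (ws ! i \<bullet> ws ! i)" for i
  define W where "W = mat_of_cols n (map (\<lambda>i. c i \<cdot>\<^sub>v ws ! i) [0..<n])"
  have wsi: "ws ! i \<in> carrier_vec n" if "i < n" for i
    using ws that by auto
  have W: "W \<in> carrier_mat n n" unfolding W_def by auto
  have col: "col W i = c i \<cdot>\<^sub>v ws ! i" if "i < n" for i
    unfolding W_def using wsi that by (subst col_mat_of_cols) auto
  \<comment> \<open>Over the reals the conjugate in \<open>corthogonal\<close> is trivial. The
    notion also excludes vectors of norm zero, so the division in \<open>c\<close> is sound.\<close>
  have orth: "ws ! i \<bullet> ws ! j = 0 \<longleftrightarrow> i \<noteq> j" if "i < n" "j < n" for i j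
    using corthogonalD[OF ws(2), of i j] ws(3) that by simp
  have "(W\<^sup>T * W) $$ (i, j) = 1\<^sub>m n $$ (i, j)" if i: "i < n" and j: "j < n" for i j
  proof -
    have "(W\<^sup>T * W) $$ (i, j) = c i * (c j * (ws ! i \<bullet> ws ! j))"
      using W i j col wsi[OF i] wsi[OF j] by simp
    moreover have "c i * (c i * (ws ! i \<bullet> ws ! i)) = 1"
    proof -
      have "ws ! i \<bullet> ws ! i \<ge> 0" by (auto simp: scalar_prod_def intro: sum_nonneg)
      thus ?thesis using orth[OF i i] by (simp add: c_def)
    qed
    ultimately show ?thesis using i j orth[OF i j] by auto
  qed
  hence "W\<^sup>T * W = 1\<^sub>m n" using W by (intro eq_matI) auto
  thus ?thesis using W col[OF n] hd by auto
qed

text \<open>Only \<open>U\<^sup>T * U = 1\<^sub>m n\<close> is recorded: for square matrices the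
  other product follows.\<close>

theorem real_symmetric_spectral:
  fixes A :: "real mat"
  assumes "A \<in> carrier_mat n n" and "A\<^sup>T = A"
  shows "\<exists>U D. U \<in> carrier_mat n n \<and> D \<in> carrier_mat n n \<and> U\<^sup>T * U = 1\<^sub>m n
    \<and> diagonal_mat D \<and> A = U * D * U\<^sup>T"
  using assms
proof (induction n arbitrary: A)
  case 0
  thus ?case by (intro exI[of _ "1\<^sub>m 0"]) (auto simp: diagonal_mat_def)
next
  case (Suc k A)
  let ?n = "Suc k"
  note A = Suc.prems(1) and sym = Suc.prems(2)
  obtain v e where ev: "eigenvector A v e"
    using real_symmetric_has_eigenvector[OF A sym] by auto
  hence v: "v \<in> carrier_vec ?n" and v0: "v \<noteq> 0\<^sub>v ?n" and Av: "A *\<^sub>v v = e \<cdot>\<^sub>v v"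
    using A unfolding eigenvector_def by auto
  obtain W c where W: "W \<in> carrier_mat ?n ?n" and WtW: "W\<^sup>T * W = 1\<^sub>m ?n"
    and col0: "col W 0 = c \<cdot>\<^sub>v v"
    using orthonormal_completion[OF v v0] by auto
  have Wt: "W\<^sup>T \<in> carrier_mat ?n ?n" using W by simp
  have WWt: "W * W\<^sup>T = 1\<^sub>m ?n" by (rule mat_mult_left_right_inverse[OF Wt W WtW])
  \<comment> \<open>\<open>A\<close> in the orthonormal basis formed by the columns of
    \<open>W\<close>, the first of which is an eigenvector.\<close>
  define A' where "A' = W\<^sup>T * (A * W)"
  have A': "A' \<in> carrier_mat ?n ?n" unfolding A'_def using A W by simp
  have A'T: "A'\<^sup>T = A'"
    unfolding A'_def using A W Wt sym
    by (simp add: transpose_mult[of _ ?n ?n _ ?n] assoc_mult_mat[of _ ?n ?n _ ?n _ ?n])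
  have sym': "A' $$ (i, j) = A' $$ (j, i)" if "i < ?n" "j < ?n" for i j
    using arg_cong[OF A'T, of "\<lambda>M. M $$ (i, j)"] A' that by simp
  have A_eq: "A = W * A' * W\<^sup>T"
  proof -
    have "W * A' * W\<^sup>T = (W * W\<^sup>T) * A * (W * W\<^sup>T)"
      unfolding A'_def using A W Wt by (simp add: assoc_mult_mat[of _ ?n ?n _ ?n _ ?n])
    thus ?thesis unfolding WWt using A by simp
  qed
  \<comment> \<open>The first column is \<open>e\<close> times the first column of the identity
    matrix, by the eigenvector equation and orthonormality.\<close>
  have col0': "A' $$ (i, 0) = (if i = 0 then e else 0)" if i: "i < ?n" for i
  proof -
    have ci: "col W j \<in> carrier_vec ?n" for j
      using W by (intro carrier_vecI) auto
    have "A' $$ (i, 0) = col W i \<bullet> (A *\<^sub>v col W 0)"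
      unfolding A'_def using A W i by (simp add: mult_mat_vec_def)
    also have "A *\<^sub>v col W 0 = e \<cdot>\<^sub>v col W 0"
      unfolding col0 using A v Av
      by (simp add: mult_mat_vec smult_smult_assoc mult.commute)
    also have "col W i \<bullet> (e \<cdot>\<^sub>v col W 0) = e * (W\<^sup>T * W) $$ (i, 0)"
      using W i ci by simp
    finally show ?thesis unfolding WtW using i by auto
  qed
  define A3 where "A3 = mat k k (\<lambda>(i, j). A' $$ (Suc i, Suc j))"
  let ?E = "mat 1 1 (\<lambda>_. e) :: real mat"
  \<comment> \<open>\<open>?O X\<close> extends a transformation of the last \<open>k\<close>
    coordinates by the identity on the first.\<close>
  let ?O = "\<lambda>X. four_block_mat (1\<^sub>m 1) (0\<^sub>m 1 k) (0\<^sub>m k 1) X :: real mat"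
  have A3: "A3 \<in> carrier_mat k k" unfolding A3_def by simp
  have "A3\<^sup>T = A3" unfolding A3_def by (rule eq_matI) (auto simp: sym')
  from Suc.IH[OF A3 this] obtain U D where U: "U \<in> carrier_mat k k"
    and D: "D \<in> carrier_mat k k" and UtU: "U\<^sup>T * U = 1\<^sub>m k" and diag: "diagonal_mat D"
    and A3_eq: "A3 = U * D * U\<^sup>T" by auto
  \<comment> \<open>The first column vanishes below the corner, and by symmetry so does the first
    row to its right.\<close>
  have A'_eq: "A' = four_block_mat ?E (0\<^sub>m 1 k) (0\<^sub>m k 1) A3"
  proof (rule eq_matI)
    fix i j
    assume "i < dim_row (four_block_mat ?E (0\<^sub>m 1 k) (0\<^sub>m k 1) A3)"
      and "j < dim_col (four_block_mat ?E (0\<^sub>m 1 k) (0\<^sub>m k 1) A3)"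
    thus "A' $$ (i, j) = four_block_mat ?E (0\<^sub>m 1 k) (0\<^sub>m k 1) A3 $$ (i, j)"
      using A3 col0'[of i] col0'[of j] sym'[of 0 j]
      by (cases i; cases j) (auto simp: A3_def)
  qed (use A' A3 in auto)
  let ?D = "four_block_mat ?E (0\<^sub>m 1 k) (0\<^sub>m k 1) D"
  have P: "?O U \<in> carrier_mat ?n ?n" and D': "?D \<in> carrier_mat ?n ?n"
    using U D by auto
  have PT: "(?O U)\<^sup>T = ?O U\<^sup>T"
    using U by (subst transpose_four_block_mat[of _ 1 1 _ k _ k]) auto
  have PtP: "(?O U)\<^sup>T * ?O U = 1\<^sub>m ?n"
  proof -
    have "?O U\<^sup>T * ?O U = ?O (U\<^sup>T * U)"
      using U by (subst mult_four_block_mat[of _ 1 1 _ k _ k _ _ 1 _ k]) auto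
    thus ?thesis unfolding PT UtU by simp
  qed
  have PDP: "?O U * ?D * (?O U)\<^sup>T = A'"
  proof -
    have "?O U * ?D = four_block_mat ?E (0\<^sub>m 1 k) (0\<^sub>m k 1) (U * D)"
      using U D by (subst mult_four_block_mat[of _ 1 1 _ k _ k _ _ 1 _ k]) auto
    moreover have "\<dots> * ?O U\<^sup>T = four_block_mat ?E (0\<^sub>m 1 k) (0\<^sub>m k 1) (U * D * U\<^sup>T)"
      using U D by (subst mult_four_block_mat[of _ 1 1 _ k _ k _ _ 1 _ k]) auto
    ultimately show ?thesis unfolding PT A'_eq A3_eq by simp
  qed
  \<comment> \<open>The required orthogonal matrix: first pass to the basis \<open>W\<close>, then
    diagonalize the lower block with \<open>U\<close>.\<close>
  have Q: "W * ?O U \<in> carrier_mat ?n ?n" using W P by simp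
  have QT: "(W * ?O U)\<^sup>T = (?O U)\<^sup>T * W\<^sup>T"
    by (rule transpose_mult[OF W P])
  have PT': "(?O U)\<^sup>T \<in> carrier_mat ?n ?n" using P by simp
  have "(W * ?O U)\<^sup>T * (W * ?O U) = (?O U)\<^sup>T * ((W\<^sup>T * W) * ?O U)"
    unfolding QT using W Wt P PT' by (simp only: assoc_mult_mat[of _ ?n ?n _ ?n _ ?n] mult_carrier_mat)
  hence "(W * ?O U)\<^sup>T * (W * ?O U) = 1\<^sub>m ?n"
    unfolding WtW left_mult_one_mat[OF P] PtP .
  moreover have "A = (W * ?O U) * ?D * (W * ?O U)\<^sup>T"
  proof -
    have "(W * ?O U) * ?D * (W * ?O U)\<^sup>T = W * (?O U * ?D * (?O U)\<^sup>T) * W\<^sup>T"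
      unfolding QT using W Wt P PT' D'
      by (simp only: assoc_mult_mat[of _ ?n ?n _ ?n _ ?n] mult_carrier_mat)
    thus ?thesis unfolding PDP A_eq[symmetric] by simp
  qed
  moreover have "diagonal_mat ?D"
    using diag D unfolding diagonal_mat_def by auto
  ultimately show ?case using Q D' by blast
qed

section \<open>Eigenvalues and quadratic forms from a spectral decomposition\<close>

text \<open>Orthogonality makes the product similar to \<open>D\<close>, and a diagonal matrix is
  upper triangular, so its characteristic polynomial factors along the diagonal.\<close>

lemma spectral_char_poly:
  fixes U D :: "real mat"
  assumes U: "U \<in> carrier_mat n n" and D: "D \<in> carrier_mat n n"
    and UtU: "U\<^sup>T * U = 1\<^sub>m n" and diag: "diagonal_mat D"
  shows "char_poly (U * D * U\<^sup>T) = (\<Prod>a\<leftarrow>diag_mat D. [:- a, 1:])"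
proof -
  have Ut: "U\<^sup>T \<in> carrier_mat n n" using U by simp
  have "similar_mat (U * D * U\<^sup>T) D"
    by (rule similar_matI[of _ _ U "U\<^sup>T" n])
      (use U D UtU mat_mult_left_right_inverse[OF Ut U UtU] in auto)
  moreover have "upper_triangular D"
    using diag D unfolding diagonal_mat_def by auto
  ultimately show ?thesis
    using char_poly_similar char_poly_upper_triangular[OF D] by metis
qed

lemma spectral_eigenvalues_mset:
  fixes U D :: "real mat"
  assumes "U \<in> carrier_mat n n" and "D \<in> carrier_mat n n"
    and "U\<^sup>T * U = 1\<^sub>m n" and "diagonal_mat D"
  shows "eigenvalues_mset (U * D * U\<^sup>T) = mset (diag_mat D)"
proof -
  have "proots (\<Prod>a\<leftarrow>xs. [:- a, 1:]) = mset xs" for xs :: "real list"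
  proof (induction xs)
    case (Cons a xs)
    \<comment> \<open>\<open>proots\<close> is additive over products of nonzero
      polynomials.\<close>
    have "(\<Prod>a\<leftarrow>xs. [:- a, 1:]) \<noteq> 0" by auto
    hence "proots ([:- a, 1:] * (\<Prod>a\<leftarrow>xs. [:- a, 1:]))
        = proots [:- a, 1:] + proots (\<Prod>a\<leftarrow>xs. [:- a, 1:])"
      by (intro proots_mult) auto
    thus ?case using Cons by (simp del: mult_pCons_left)
  qed simp
  thus ?thesis
    unfolding eigenvalues_mset_def spectral_char_poly[OF assms] .
qed

lemma spectral_eigenvalue:
  fixes U D :: "real mat"
  assumes "U \<in> carrier_mat n n" and "D \<in> carrier_mat n n"
    and "U\<^sup>T * U = 1\<^sub>m n" and "diagonal_mat D" and i: "i < n"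
  shows "eigenvalue (U * D * U\<^sup>T) (D $$ (i, i))"
proof -
  have "D $$ (i, i) \<in> set (diag_mat D)"
    using assms(2) i unfolding diag_mat_def by auto
  hence "poly (char_poly (U * D * U\<^sup>T)) (D $$ (i, i)) = 0"
    unfolding spectral_char_poly[OF assms(1-4)]
    by (auto simp: poly_prod_list)
  thus ?thesis
    using assms(1,2) by (subst eigenvalue_root_char_poly[of _ n]) auto
qed

text \<open>Gives \<open>Max\<close> and \<open>Min\<close> in \<open>lambda_max\<close> and
  \<open>lambda_min\<close> their bounding property.\<close>

lemma finite_eigenvalues:
  fixes X :: "real mat"
  assumes X: "X \<in> carrier_mat n n"
  shows "finite {l. eigenvalue X l}"
proof -
  have "char_poly X \<noteq> 0" using degree_monic_char_poly[OF X] by auto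
  thus ?thesis
    unfolding eigenvalue_root_char_poly[OF X] by (rule poly_roots_finite)
qed

lemma lambda_max_ge:
  assumes "X \<in> carrier_mat n n" and "eigenvalue X l"
  shows "l \<le> lambda_max X"
  unfolding lambda_max_def using assms finite_eigenvalues by (intro Max_ge) auto

lemma lambda_min_le:
  assumes "X \<in> carrier_mat n n" and "eigenvalue X l"
  shows "lambda_min X \<le> l"
  unfolding lambda_min_def using assms finite_eigenvalues by (intro Min_le) auto

text \<open>The Rayleigh bound: in the coordinates \<open>w = U\<^sup>T *\<^sub>v v\<close> the form
  is a sum of squares weighted by eigenvalues, and \<open>w\<close> has the same norm as
  \<open>v\<close>.\<close>

lemma quadratic_form_le_lambda_max:
  assumes X: "X \<in> sym_mats n" and v: "v \<in> carrier_vec n"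
  shows "v \<bullet> (X *\<^sub>v v) \<le> lambda_max X * (v \<bullet> v)"
proof -
  have Xc: "X \<in> carrier_mat n n" and sym: "X\<^sup>T = X" using X unfolding sym_mats_def by auto
  obtain U D where U: "U \<in> carrier_mat n n" and D: "D \<in> carrier_mat n n"
    and UtU: "U\<^sup>T * U = 1\<^sub>m n" and diag: "diagonal_mat D" and X_eq: "X = U * D * U\<^sup>T"
    using real_symmetric_spectral[OF Xc sym] by auto
  have Ut: "U\<^sup>T \<in> carrier_mat n n" using U by simp
  define w where "w = U\<^sup>T *\<^sub>v v"
  have w: "w \<in> carrier_vec n" unfolding w_def using Ut v by simp
  have Dw: "(D *\<^sub>v w) $ i = D $$ (i, i) * w $ i" if i: "i < n" for i
  proof -
    have "(D *\<^sub>v w) $ i = (\<Sum>j = 0..<n. D $$ (i, j) * w $ j)"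
      using D w i by (auto simp: scalar_prod_def)
    also have "\<dots> = (\<Sum>j = 0..<n. if j = i then D $$ (i, i) * w $ i else 0)"
      using diag D i unfolding diagonal_mat_def by (intro sum.cong) auto
    finally show ?thesis using i by simp
  qed
  have "v \<bullet> (X *\<^sub>v v) = v \<bullet> (U *\<^sub>v (D *\<^sub>v w))"
    unfolding X_eq w_def using U D Ut v by (simp add: assoc_mult_mat_vec[of _ n n _ n])
  also have "\<dots> = w \<bullet> (D *\<^sub>v w)"
    unfolding w_def using transpose_vec_mult_scalar[OF U _ v, of "D *\<^sub>v w"] D w
    by (simp add: w_def)
  also have "\<dots> = (\<Sum>i = 0..<n. D $$ (i, i) * (w $ i)\<^sup>2)"
    using Dw D w by (auto simp: scalar_prod_def power2_eq_square intro!: sum.cong)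
  also have "\<dots> \<le> (\<Sum>i = 0..<n. lambda_max X * (w $ i)\<^sup>2)"
    using lambda_max_ge[OF Xc] spectral_eigenvalue[OF U D UtU diag] X_eq
    by (intro sum_mono mult_right_mono) auto
  also have "\<dots> = lambda_max X * (w \<bullet> w)"
    using w by (simp add: scalar_prod_def power2_eq_square sum_distrib_left)
  also have "w \<bullet> w = v \<bullet> (U *\<^sub>v w)"
    using transpose_vec_mult_scalar[OF U w v] by (simp add: w_def)
  also have "U *\<^sub>v w = v"
    unfolding w_def using mat_mult_left_right_inverse[OF Ut U UtU] U Ut v
    by (metis assoc_mult_mat_vec one_mult_mat_vec)
  finally show ?thesis .
qed

section \<open>The trace inner product and its spectral bounds\<close>

lemma mat_inner_sum:
  assumes "X \<in> carrier_mat n n" and "Y \<in> carrier_mat n n"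
  shows "mat_inner X Y = (\<Sum>i<n. \<Sum>j<n. X $$ (i, j) * Y $$ (j, i))"
  using assms unfolding mat_inner_def mat_trace_def
  by (auto simp: scalar_prod_def atLeast0LessThan intro!: sum.cong)

lemma mat_inner_commute:
  assumes "X \<in> carrier_mat n n" and "Y \<in> carrier_mat n n"
  shows "mat_inner X Y = mat_inner Y X"
  unfolding mat_inner_sum[OF assms] mat_inner_sum[OF assms(2,1)]
  by (subst sum.swap) (simp add: mult.commute)

text \<open>Rotating the factors under the trace moves \<open>U\<close> to the right of
  \<open>X\<close>. Against the diagonal \<open>D\<close>, only the diagonal entries of
  \<open>U\<^sup>T * (X * U)\<close> survive, and these are the quadratic forms at the columns of
  \<open>U\<close>.\<close>

lemma mat_inner_spectral:
  assumes U: "U \<in> carrier_mat n n" and D: "D \<in> carrier_mat n n"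
    and diag: "diagonal_mat D" and X: "X \<in> carrier_mat n n"
  shows "mat_inner (U * D * U\<^sup>T) X = (\<Sum>i<n. D $$ (i, i) * (col U i \<bullet> (X *\<^sub>v col U i)))"
proof -
  have Ut: "U\<^sup>T \<in> carrier_mat n n" using U by simp
  let ?M = "U\<^sup>T * (X * U)"
  have M: "?M \<in> carrier_mat n n" using U Ut X by simp
  have "mat_inner (U * D * U\<^sup>T) X = mat_inner U (D * (U\<^sup>T * X))"
    unfolding mat_inner_def using U D Ut X by (simp add: assoc_mult_mat[of _ n n _ n _ n])
  also have "\<dots> = mat_inner (D * (U\<^sup>T * X)) U"
    using U D Ut X by (intro mat_inner_commute) auto
  also have "\<dots> = mat_inner D ?M"
    unfolding mat_inner_def using U D Ut X by (simp add: assoc_mult_mat[of _ n n _ n _ n])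
  also have "\<dots> = (\<Sum>i<n. \<Sum>j<n. if j = i then D $$ (i, i) * ?M $$ (i, i) else 0)"
    unfolding mat_inner_sum[OF D M]
    using diag D unfolding diagonal_mat_def by (intro sum.cong) auto
  also have "\<dots> = (\<Sum>i<n. D $$ (i, i) * ?M $$ (i, i))"
    by simp
  also have "\<dots> = (\<Sum>i<n. D $$ (i, i) * (col U i \<bullet> (X *\<^sub>v col U i)))"
    using U X by (intro sum.cong) (auto simp: mult_mat_vec_def)
  finally show ?thesis .
qed

text \<open>Replacing the filter by \<open>min 0\<close> gives a sum over all indices, which can be
  compared term by term.\<close>

lemma sum_mset_negative_diag:
  assumes "D \<in> carrier_mat n n"
  shows "(\<Sum>l\<in>#{#l \<in># mset (diag_mat D). l < 0#}. l) = (\<Sum>i<n. min 0 (D $$ (i, i) :: real))"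
proof -
  have "(\<Sum>l\<in>#{#l \<in># mset xs. l < 0#}. l) = (\<Sum>x\<leftarrow>xs. min 0 x)" for xs :: "real list"
    by (induction xs) auto
  moreover have "(\<Sum>x\<leftarrow>diag_mat D. min 0 x) = (\<Sum>i<n. min 0 (D $$ (i, i)))"
    using assms unfolding diag_mat_def
    by (simp add: comp_def interv_sum_list_conv_sum_set_nat atLeast0LessThan)
  ultimately show ?thesis by simp
qed

lemma psd_inner_ge_negative_eigenvalues:
  assumes Z: "Z \<in> sym_mats n" and X: "X \<in> psd_mats n" and x: "lambda_max X \<le> x"
  shows "x * (\<Sum>l\<in>#{#l \<in># eigenvalues_mset Z. l < 0#}. l) \<le> mat_inner Z X"
proof -
  have Zc: "Z \<in> carrier_mat n n" and symZ: "Z\<^sup>T = Z" using Z unfolding sym_mats_def by auto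
  have Xs: "X \<in> sym_mats n" and psd: "\<And>v. v \<in> carrier_vec n \<Longrightarrow> v \<bullet> (X *\<^sub>v v) \<ge> 0"
    using X unfolding psd_mats_def by auto
  have Xc: "X \<in> carrier_mat n n" using Xs unfolding sym_mats_def by auto
  obtain U D where U: "U \<in> carrier_mat n n" and D: "D \<in> carrier_mat n n"
    and UtU: "U\<^sup>T * U = 1\<^sub>m n" and diag: "diagonal_mat D" and Z_eq: "Z = U * D * U\<^sup>T"
    using real_symmetric_spectral[OF Zc symZ] by auto
  have "x * min 0 (D $$ (i, i)) \<le> D $$ (i, i) * (col U i \<bullet> (X *\<^sub>v col U i))"
    if i: "i < n" for i
  proof -
    let ?q = "col U i \<bullet> (X *\<^sub>v col U i)"
    have c: "col U i \<in> carrier_vec n" using U by (intro carrier_vecI) auto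
    \<comment> \<open>The columns of \<open>U\<close> are unit vectors, so the Rayleigh bound reads
      \<open>?q \<le> lambda_max X\<close>.\<close>
    have "col U i \<bullet> col U i = (U\<^sup>T * U) $$ (i, i)" using U i by simp
    hence "?q \<le> x" and "?q \<ge> 0"
      using quadratic_form_le_lambda_max[OF Xs c] psd[OF c] x i by (auto simp: UtU)
    \<comment> \<open>A nonpositive eigenvalue reverses \<open>?q \<le> x\<close>; for a positive
      one the left side is zero and \<open>?q \<ge> 0\<close> suffices.\<close>
    show ?thesis
    proof (cases "D $$ (i, i) \<le> 0")
      case True
      thus ?thesis using mult_left_mono_neg[OF \<open>?q \<le> x\<close> True] by (simp add: mult.commute)
    next
      case False
      thus ?thesis using \<open>?q \<ge> 0\<close> by simp
    qed
  qed
  thus ?thesis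
    unfolding Z_eq mat_inner_spectral[OF U D diag Xc]
      spectral_eigenvalues_mset[OF U D UtU diag] sum_mset_negative_diag[OF D] sum_distrib_left
    by (intro sum_mono) auto
qed

text \<open>Each of the \<open>n\<close> diagonal entries of \<open>D\<close> is an eigenvalue,
  hence at least \<open>z\<close>, and \<open>min 0\<close> is monotone.\<close>

lemma sum_negative_eigenvalues_ge:
  assumes Z: "Z \<in> sym_mats n" and z: "z \<le> lambda_min Z"
  shows "real n * min 0 z \<le> (\<Sum>l\<in>#{#l \<in># eigenvalues_mset Z. l < 0#}. l)"
proof -
  have Zc: "Z \<in> carrier_mat n n" and symZ: "Z\<^sup>T = Z" using Z unfolding sym_mats_def by auto
  obtain U D where U: "U \<in> carrier_mat n n" and D: "D \<in> carrier_mat n n"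
    and UtU: "U\<^sup>T * U = 1\<^sub>m n" and diag: "diagonal_mat D" and Z_eq: "Z = U * D * U\<^sup>T"
    using real_symmetric_spectral[OF Zc symZ] by auto
  have "z \<le> D $$ (i, i)" if "i < n" for i
    using lambda_min_le[OF Zc] spectral_eigenvalue[OF U D UtU diag that] z
    unfolding Z_eq by force
  hence "(\<Sum>i<n. min 0 z) \<le> (\<Sum>i<n. min 0 (D $$ (i, i)))"
    by (intro sum_mono min.mono) auto
  thus ?thesis
    unfolding Z_eq spectral_eigenvalues_mset[OF U D UtU diag] sum_mset_negative_diag[OF D]
    by simp
qed

text \<open>Test the Rayleigh bound on a unit vector, which exists as \<open>n > 0\<close>. This
  fixes the sign of \<open>x_bar\<close> for the second inequality of the theorem.\<close>

lemma psd_lambda_max_nonneg: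
  assumes X: "X \<in> psd_mats n" and n: "n > 0"
  shows "lambda_max X \<ge> 0"
proof -
  let ?v = "unit_vec n 0 :: real vec"
  have "0 \<le> ?v \<bullet> (X *\<^sub>v ?v)" using X unfolding psd_mats_def by auto
  also have "\<dots> \<le> lambda_max X * (?v \<bullet> ?v)"
    using X unfolding psd_mats_def by (intro quadratic_form_le_lambda_max[of _ n]) auto
  finally show ?thesis using n by simp
qed

section \<open>Weak duality: the nonnegative slack, the adjoint and the attained value\<close>

lemma mat_inner_nonneg:
  assumes X: "X \<in> carrier_mat n n" and Y: "Y \<in> carrier_mat n n"
    and "nonneg_entries X" and "nonneg_entries Y"
  shows "mat_inner X Y \<ge> 0"
  using assms(3,4) X Y unfolding mat_inner_sum[OF X Y] nonneg_entries_def
  by (intro sum_nonneg mult_nonneg_nonneg) auto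

lemma adj_op_carrier: "adj_op n m A y \<in> carrier_mat n n"
  unfolding adj_op_def by simp

lemma adj_op_index:
  assumes "\<And>k. k < m \<Longrightarrow> A k \<in> carrier_mat n n" and "i < n" and "j < n"
  shows "adj_op n m A y $$ (i, j) = (\<Sum>k<m. y $ k * A k $$ (i, j))"
proof -
  have "(y $ k \<cdot>\<^sub>m A k) $$ (i, j) = y $ k * A k $$ (i, j)" if "k < m" for k
    using assms(1)[OF that] assms(2,3) by auto
  thus ?thesis using assms(2,3) unfolding adj_op_def by simp
qed

lemma adj_op_sym:
  assumes "\<And>k. k < m \<Longrightarrow> A k \<in> sym_mats n"
  shows "adj_op n m A y \<in> sym_mats n"
proof -
  have A: "A k \<in> carrier_mat n n" "(A k)\<^sup>T = A k" if "k < m" for k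
    using assms that unfolding sym_mats_def by auto
  have "A k $$ (j, i) = A k $$ (i, j)" if "k < m" "i < n" "j < n" for i j k
    using arg_cong[OF A(2)[OF that(1)], of "\<lambda>M. M $$ (i, j)"] A(1)[OF that(1)] that by simp
  thus ?thesis
    unfolding sym_mats_def using adj_op_carrier[of n m A y]
    by (auto simp: adj_op_index[OF A(1)] intro!: eq_matI sum.cong)
qed

text \<open>The adjoint identity: expand into a triple sum and move the sum over \<open>k\<close>
  outermost.\<close>

lemma mat_inner_adj_op:
  assumes A: "\<And>k. k < m \<Longrightarrow> A k \<in> carrier_mat n n" and X: "X \<in> carrier_mat n n"
    and y: "y \<in> carrier_vec m"
  shows "mat_inner (adj_op n m A y) X = lin_op m A X \<bullet> y"
proof -
  have "mat_inner (adj_op n m A y) X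
      = (\<Sum>i<n. \<Sum>j<n. \<Sum>k<m. y $ k * (A k $$ (i, j) * X $$ (j, i)))"
    unfolding mat_inner_sum[OF adj_op_carrier X]
    by (intro sum.cong) (auto simp: adj_op_index[OF A] sum_distrib_right mult.assoc)
  also have "\<dots> = (\<Sum>i<n. \<Sum>k<m. \<Sum>j<n. y $ k * (A k $$ (i, j) * X $$ (j, i)))"
    by (intro sum.cong[OF refl] sum.swap)
  also have "\<dots> = (\<Sum>k<m. \<Sum>i<n. \<Sum>j<n. y $ k * (A k $$ (i, j) * X $$ (j, i)))"
    by (rule sum.swap)
  also have "\<dots> = (\<Sum>k<m. y $ k * mat_inner (A k) X)"
    by (intro sum.cong[OF refl]) (simp add: mat_inner_sum[OF A X] sum_distrib_left)
  also have "\<dots> = lin_op m A X \<bullet> y"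
    using y unfolding lin_op_def
    by (auto simp: scalar_prod_def atLeast0LessThan mult.commute intro!: sum.cong)
  finally show ?thesis .
qed

lemma mat_inner_minus_left:
  assumes X: "X \<in> carrier_mat n n" and Y: "Y \<in> carrier_mat n n" and W: "W \<in> carrier_mat n n"
  shows "mat_inner (X - Y) W = mat_inner X W - mat_inner Y W"
proof -
  have "X - Y \<in> carrier_mat n n" by (rule minus_carrier_mat[OF Y])
  thus ?thesis
    using X Y by (simp add: mat_inner_sum[OF _ W] sum_subtractf left_diff_distrib)
qed

lemma sym_mats_minus:
  assumes "X \<in> sym_mats n" and "Y \<in> sym_mats n"
  shows "X - Y \<in> sym_mats n"
  using assms minus_carrier_mat[of Y n n X] transpose_minus[of X n n Y]
  unfolding sym_mats_def by simp

text \<open>An optimal \<open>X\<close> attains the infimum, so the conditionally complete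
  \<open>INF\<close> is a minimum.\<close>

lemma dnn_value_optimal:
  assumes "dnn_optimal n m C A b X"
  shows "dnn_value n m C A b = mat_inner C X"
  using assms unfolding dnn_optimal_def dnn_value_def
  by (intro cInf_eq_minimum) auto

theorem theorem1:
  fixes n m :: nat
    and C S Xopt Z :: "real mat"
    and A :: "nat \<Rightarrow> real mat"
    and b y :: "real vec"
    and z_low x_bar :: real
  assumes "n \<ge> 1"
    and "C \<in> sym_mats n"
    and "\<And>i. i < m \<Longrightarrow> A i \<in> sym_mats n"
    and "b \<in> carrier_vec m"
    and "dnn_optimal n m C A b Xopt"
    and "y \<in> carrier_vec m"
    and "S \<in> sym_mats n"
    and "nonneg_entries S"
    and "Z = C - adj_op n m A y - S"
    and "z_low \<le> lambda_min Z"
    and "x_bar \<ge> lambda_max Xopt"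
  shows "dnn_value n m C A b \<ge> b \<bullet> y + x_bar * (\<Sum>l\<in>#{#l \<in># eigenvalues_mset Z. l < 0#}. l)
    \<and> b \<bullet> y + x_bar * (\<Sum>l\<in>#{#l \<in># eigenvalues_mset Z. l < 0#}. l)
        \<ge> b \<bullet> y + real n * x_bar * min 0 z_low"
proof -
  have A: "A k \<in> carrier_mat n n" if "k < m" for k
    using assms(3)[OF that] unfolding sym_mats_def by auto
  have C: "C \<in> carrier_mat n n" and S: "S \<in> carrier_mat n n"
    using assms(2,7) unfolding sym_mats_def by auto
  have psd: "Xopt \<in> psd_mats n" and lin: "lin_op m A Xopt = b" and nonneg: "nonneg_entries Xopt"
    using assms(5) unfolding dnn_optimal_def dnn_feasible_def by auto
  have X: "Xopt \<in> carrier_mat n n" using psd unfolding psd_mats_def sym_mats_def by auto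
  have adj: "adj_op n m A y \<in> sym_mats n" using assms(3) by (rule adj_op_sym)
  have Z: "Z \<in> sym_mats n"
    unfolding assms(9) using assms(2,7) adj by (intro sym_mats_minus)
  let ?s = "\<Sum>l\<in>#{#l \<in># eigenvalues_mset Z. l < 0#}. l"
  \<comment> \<open>Primal feasibility turns the adjoint term into
    \<open>b \<bullet> y\<close>.\<close>
  have "mat_inner Z Xopt = mat_inner C Xopt - b \<bullet> y - mat_inner S Xopt"
    unfolding assms(9) using C S X adj_op_carrier[of n m A y]
    by (simp add: minus_carrier_mat mat_inner_minus_left[of _ n] mat_inner_adj_op[OF A X assms(6)] lin)
  moreover have "x_bar * ?s \<le> mat_inner Z Xopt"
    by (rule psd_inner_ge_negative_eigenvalues[OF Z psd assms(11)])
  moreover have "mat_inner S Xopt \<ge> 0"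
    by (rule mat_inner_nonneg[OF S X assms(8) nonneg])
  ultimately have "b \<bullet> y + x_bar * ?s \<le> dnn_value n m C A b"
    unfolding dnn_value_optimal[OF assms(5)] by linarith
  \<comment> \<open>Multiplication by \<open>x_bar\<close> keeps the order because
    \<open>x_bar \<ge> lambda_max Xopt \<ge> 0\<close>.\<close>
  moreover have "x_bar * (real n * min 0 z_low) \<le> x_bar * ?s"
    using sum_negative_eigenvalues_ge[OF Z assms(10)] psd_lambda_max_nonneg[OF psd] assms(1,11)
    by (intro mult_left_mono) auto
  ultimately show ?thesis by (simp add: mult.assoc mult.left_commute)
qed

end
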